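(* Let $h>0$ and $\lambda\in\mathbb{C}$, and consider a Runge--Kutta method with $p$ stages, given by a real $p\times p$ matrix $A=(a_{ij})$ and a real vector $b=(b_1,\dots,b_p)^\top$. Let the target equation be $\dot{x}(t)=\lambda x$ with $x:t\in\mathbb{R}\mapsto x(t)\in\mathbb{C}$, so that the training data are pairs $(x_{\mathrm d}^{(n)},x_{\mathrm d}^{(n+1)})$ with $x_{\mathrm d}^{(n+1)}=\mathrm{e}^{h\lambda}x_{\mathrm d}^{(n)}$, and let the model equation be discretized by this Runge--Kutta method with step size $h$. Then there exists $\alpha\in\mathbb{C}$ such that the model $\dot{\hat{x}}=\hat{f}(\hat{x})$ with $\hat{f}(\hat{x})=\alpha\hat{x}$ reduces the loss function $$\sum_{x_{\mathrm d}^{(n)}}\left\| \mathrm{e}^{h\lambda}x_{\mathrm d}^{(n)}-\hat{x}^{(n+1)}\right\|$$ to zero. Moreover, $\alpha$ is a solution to $$1+h\alpha\, b^{\top}(I-h\alpha A)^{-1}\mathbf{1}-\mathrm{e}^{h\lambda}=0,\qquad \det(I-h\alpha A)\neq 0,\qquad \mathbf{1}=(1\ 1\ \cdots\ 1)^\top .$$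
   Context: A Runge--Kutta method with $p$ stages, applied with step size $h$ to $\dot{\hat{x}}=\hat{f}(\hat{x})$, is $$\hat{x}^{(n+1)}=\hat{x}^{(n)}+h\sum_{i=1}^{p}b_i k_i,\qquad k_i=\hat{f}\Big(\hat{x}^{(n)}+h\sum_{j=1}^{p}a_{ij}k_j\Big),\quad i=1,\dots,p,$$ where the constants $p$, $a_{ij}$, $b_j$ define the method (explicit or implicit), $A=(a_{ij})$ and $b=(b_j)$. The data set $\mathcal{D}$ consists of noise-free pairs $(x_{\mathrm d}^{(n)},x_{\mathrm d}^{(n+1)})$ of states of the target dynamics sampled at fixed time spacing $h$; $x_{\mathrm d}^{(n)}$ is the state at time $nh$. The amount of data is assumed sufficient (in particular, not all the $x_{\mathrm d}^{(n)}$ are zero). In the loss function, the sum is over the pairs in $\mathcal{D}$, $\|\cdot\|$ is a specified norm, and $\hat{x}^{(n+1)}$ is the result of one step of the Runge--Kutta method applied to the model, started from $\hat{x}^{(n)}=x_{\mathrm d}^{(n)}$. For $\hat{f}(\hat{x})=\alpha\hat{x}$, with $k=(k_1,\dots,k_p)^\top$, this step reads $\hat{x}^{(n+1)}=x_{\mathrm d}^{(n)}+h\,b^\top k$, $k=\alpha(x_{\mathrm d}^{(n)}\mathbf{1}+hAk)$. $I$ is the $p\times p$ identity matrix.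
   Formalization: Added: with w=e^{hλ}, P(z)=det(I−zA+z1bᵀ), Q(z)=det(I−zA), P−wQ divides no power of Q. This is equivalent to solvability of the equation with nonzero determinant; the claim fails otherwise, e.g. for b=0, w≠1, or implicit midpoint with w=−1. *)

theory Defs
  imports "HOL-Analysis.Analysis" "HOL-Computational_Algebra.Polynomial"
begin

definition rk_stages ::
    "real ^ 'p ^ 'p \<Rightarrow> real \<Rightarrow> ('a::real_vector \<Rightarrow> 'a) \<Rightarrow> 'a \<Rightarrow> ('p::finite \<Rightarrow> 'a) \<Rightarrow> bool" where
  "rk_stages A h f x k \<longleftrightarrow>
     (\<forall>i. k i = f (x + h *\<^sub>R (\<Sum>j\<in>UNIV. (A $ i $ j) *\<^sub>R k j)))"

text \<open>
  The stage equations of an implicit method need not have exactly one solution. The value below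
  is meaningful only if they do; wherever the step is used this is required explicitly.
\<close>

definition rk_step ::
    "real ^ 'p ^ 'p \<Rightarrow> real ^ 'p::finite \<Rightarrow> real \<Rightarrow> ('a::real_vector \<Rightarrow> 'a) \<Rightarrow> 'a \<Rightarrow> 'a" where
  "rk_step A b h f x =
     x + h *\<^sub>R (\<Sum>i\<in>UNIV. (b $ i) *\<^sub>R (THE k. rk_stages A h f x k) i)"

text \<open>
  Homogeneity is required for real scalars only, so every norm of the complex numbers viewed as
  the real plane is covered.
\<close>

definition is_norm :: "('a::real_vector \<Rightarrow> real) \<Rightarrow> bool" where
  "is_norm N \<longleftrightarrow>
     (\<forall>x. N x = 0 \<longleftrightarrow> x = 0) \<and> (\<forall>c x. N (c *\<^sub>R x) = \<bar>c\<bar> * N x) \<and> (\<forall>x y. N (x + y) \<le> N x + N y)"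

definition solves_target :: "complex \<Rightarrow> (real \<Rightarrow> complex) \<Rightarrow> bool" where
  "solves_target lam u \<longleftrightarrow> (\<forall>t. (u has_vector_derivative lam * u t) (at t))"

text \<open>The matrix \<open>I - z A\<close>.\<close>

definition rk_matrix :: "real ^ 'p ^ 'p \<Rightarrow> complex \<Rightarrow> complex ^ 'p ^ 'p::finite" where
  "rk_matrix A z = mat 1 - (\<chi> i j. z * of_real (A $ i $ j))"

text \<open>
  Where \<open>det (I - z A)\<close> is nonzero, the stability function
  \<open>R z = 1 + z b\<^sup>T (I - z A)\<^sup>-\<^sup>1 1\<close> of the method is the quotient \<open>P z / Q z\<close> of the polynomials
  \<open>P z = det (I - z A + z 1 b\<^sup>T)\<close> and \<open>Q z = det (I - z A)\<close>, by the matrix determinant lemma.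
\<close>

definition rk_num :: "real ^ 'p ^ 'p \<Rightarrow> real ^ 'p::finite \<Rightarrow> complex poly" where
  "rk_num A b = det (mat 1 - (\<chi> i j. [:0, of_real (A $ i $ j):]) + (\<chi> i j. [:0, of_real (b $ j):]))"

definition rk_den :: "real ^ 'p ^ 'p::finite \<Rightarrow> complex poly" where
  "rk_den A = det (mat 1 - (\<chi> i j. [:0, of_real (A $ i $ j):]))"

text \<open>
  Some methods do not take every nonzero value \<open>w\<close> as a stability value \<open>R z\<close>: if \<open>b = 0\<close>, then
  \<open>R = 1\<close>, and the implicit midpoint rule omits \<open>w = -1\<close>, the value of \<open>R\<close> at infinity. For such
  \<open>w = exp (h lam)\<close> no linear model reproduces the data (see the lemma below). The condition
  excludes exactly these cases: \<open>P - w Q\<close> must not be a nonzero constant, and its roots must not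
  all be lost to \<open>det (I - z A) = 0\<close>.

  It is satisfied, for example, by every explicit method with nonconstant \<open>R\<close>, since then \<open>Q = 1\<close>.
\<close>

definition rk_regular_value :: "real ^ 'p ^ 'p \<Rightarrow> real ^ 'p::finite \<Rightarrow> complex \<Rightarrow> bool" where
  "rk_regular_value A b w \<longleftrightarrow> (\<forall>m. \<not> (rk_num A b - smult w (rk_den A)) dvd rk_den A ^ m)"

lemma implicit_midpoint_no_solution:
  fixes A :: "real ^ 1 ^ 1" and b :: "real ^ 1"
  defines "A \<equiv> (\<chi> i j. 1 / 2)" and "b \<equiv> (\<chi> i. 1)"
  shows "\<not> (\<exists>\<alpha>. det (rk_matrix A \<alpha>) \<noteq> 0 \<and>
     1 + \<alpha> * (\<Sum>i\<in>UNIV. of_real (b $ i) * (matrix_inv (rk_matrix A \<alpha>) *v (\<chi> i. 1)) $ i)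
       - exp (\<i> * of_real pi) = 0)"
proof
  assume "\<exists>\<alpha>. det (rk_matrix A \<alpha>) \<noteq> 0 \<and>
     1 + \<alpha> * (\<Sum>i\<in>UNIV. of_real (b $ i) * (matrix_inv (rk_matrix A \<alpha>) *v (\<chi> i. 1)) $ i)
       - exp (\<i> * of_real pi) = 0"
  then obtain \<alpha> where d: "det (rk_matrix A \<alpha>) \<noteq> 0" and e:
    "1 + \<alpha> * (\<Sum>i\<in>UNIV. of_real (b $ i) * (matrix_inv (rk_matrix A \<alpha>) *v (\<chi> i. 1)) $ i)
       - exp (\<i> * of_real pi) = 0"
    by blast
  define v :: "complex ^ 1" where "v = matrix_inv (rk_matrix A \<alpha>) *v (\<chi> i. 1)"
  have "rk_matrix A \<alpha> ** matrix_inv (rk_matrix A \<alpha>) = mat 1"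
    using d unfolding invertible_det_nz [symmetric] invertible_def matrix_inv_def
    by (rule someI2_ex) blast
  then have "rk_matrix A \<alpha> *v v = (\<chi> i. 1)"
    by (simp add: v_def matrix_vector_mul_assoc)
  then have "(rk_matrix A \<alpha> *v v) $ 1 = 1" by simp
  then have "(1 - \<alpha> / 2) * v $ 1 = 1"
    by (simp add: matrix_vector_mult_def rk_matrix_def mat_def A_def sum_1)
  moreover have "1 + \<alpha> * v $ 1 + 1 = 0"
    using e by (simp add: b_def v_def [symmetric] sum_1)
  ultimately show False by (simp add: algebra_simps) algebra
qed

end

theory Submission
  imports Defs "HOL-Computational_Algebra.Fundamental_Theorem_Algebra"
begin

text \<open>
  On data \<open>(x, e\<^sup>h\<^sup>\<lambda> x)\<close> the model \<open>\<alpha> z\<close> makes the step \<open>x \<mapsto> R (h \<alpha>) x\<close>, so the loss vanishes exactly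
  when \<open>R (h \<alpha>) = w\<close> for \<open>w = exp (h \<lambda>)\<close>. By the matrix determinant lemma this says
  \<open>P - w Q = 0\<close> at the point \<open>h \<alpha>\<close> with \<open>Q \<noteq> 0\<close> there. If there were no such point, every root of
  \<open>P - w Q\<close> would be a root of \<open>Q\<close>, and the Nullstellensatz in one variable would make \<open>P - w Q\<close>
  divide a power of \<open>Q\<close>. Conversely, uniqueness of the stages at a nonzero datum forces
  \<open>I - h \<alpha> A\<close> to be injective.
\<close>

text \<open>Row \<open>k\<close> is \<open>c\<close> itself, so subtracting multiples of it clears
  the terms \<open>v $ i *s c\<close> in the rows of \<open>S\<close> without changing the
  determinant. The induction does this one row at a time.\<close>

lemma det_unit_rows_rank_one:
  fixes v c :: "'a::field ^ 'n::finite"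
  assumes "finite S" and "k \<notin> S"
  shows "det (\<chi> i. if i = k then c else axis i 1 + (if i \<in> S then v $ i *s c else 0)) = c $ k"
  using assms
proof (induction S rule: finite_induct)
  case empty
  \<comment> \<open>Writing \<open>c\<close> as a combination of the unit rows makes the empty case
    an instance of Cramer's rule for the identity matrix.\<close>
  have "(\<Sum>i\<in>UNIV. c $ i *s row i (mat 1 :: 'a^'n^'n)) = c"
    by (simp add: vec_eq_iff row_def mat_def if_distrib [of "\<lambda>x. _ * x"] cong: if_cong)
  moreover have "row i (mat 1 :: 'a^'n^'n) = axis i 1" for i
    by (simp add: vec_eq_iff row_def mat_def axis_def)
  ultimately have "det (\<chi> i. if i = k then c else axis i 1) = c $ k"
    using cramer_lemma_transpose [of k c "mat 1"] by (simp cong: if_cong)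
  then show ?case by (simp cong: if_cong)
next
  case (insert l S)
  let ?r = "\<lambda>i. if i = k then c else axis i 1 + (if i \<in> S then v $ i *s c else 0)"
  have lk: "l \<noteq> k" using insert.prems by auto
  have "(\<chi> i. if i = k then c else axis i 1 + (if i \<in> insert l S then v $ i *s c else 0))
      = (\<chi> i. if i = l then axis l 1 + v $ l *s c else ?r i)"
    using lk by (auto simp: vec_eq_iff)
  then have "det (\<chi> i. if i = k then c else axis i 1 + (if i \<in> insert l S then v $ i *s c else 0))
      = det (\<chi> i. if i = l then axis l 1 else ?r i) + v $ l * det (\<chi> i. if i = l then c else ?r i)"
    by (simp only: det_row_add det_row_mul)
  \<comment> \<open>Rows \<open>l\<close> and \<open>k\<close> both equal \<open>c\<close>.\<close>
  also have "det (\<chi> i. if i = l then c else ?r i) = 0"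
    by (rule det_identical_rows [OF lk]) (simp add: vec_eq_iff row_def)
  also have "(\<chi> i. if i = l then axis l 1 else ?r i) = (\<chi> i. ?r i)"
    using lk insert.hyps by (auto simp: vec_eq_iff)
  finally show ?case using insert by simp
qed

text \<open>Multilinearity in the rows, one index at a time: splitting row \<open>k\<close> leaves
  the determinant for the smaller set plus \<open>v $ k\<close> times a determinant whose row
  \<open>k\<close> is \<open>c\<close>, and the latter is \<open>c $ k\<close> by the previous
  lemma.\<close>

lemma det_mat_1_plus_rank_one:
  fixes v c :: "'a::field ^ 'n::finite"
  shows "det (mat 1 + (\<chi> i j. v $ i * c $ j)) = 1 + (\<Sum>i\<in>UNIV. c $ i * v $ i)"
proof -
  have "det (\<chi> i. axis i 1 + (if i \<in> S then v $ i *s c else 0)) = 1 + (\<Sum>i\<in>S. c $ i * v $ i)"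
    if "finite S" for S
    using that
  proof (induction S rule: finite_induct)
    case empty
    have "(\<chi> i. axis i 1) = (mat 1 :: 'a^'n^'n)"
      by (auto simp: vec_eq_iff mat_def axis_def)
    then show ?case by simp
  next
    case (insert k S)
    let ?r = "\<lambda>i. axis i 1 + (if i \<in> S then v $ i *s c else 0)"
    have "(\<chi> i. axis i 1 + (if i \<in> insert k S then v $ i *s c else 0))
        = (\<chi> i. if i = k then axis k 1 + v $ k *s c else ?r i)"
      by (auto simp: vec_eq_iff)
    then have "det (\<chi> i. axis i 1 + (if i \<in> insert k S then v $ i *s c else 0))
        = det (\<chi> i. if i = k then axis k 1 else ?r i) + v $ k * det (\<chi> i. if i = k then c else ?r i)"
      by (simp only: det_row_add det_row_mul)
    also have "det (\<chi> i. if i = k then c else ?r i) = c $ k"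
      using insert.hyps by (rule det_unit_rows_rank_one)
    also have "(\<chi> i. if i = k then axis k 1 else ?r i) = (\<chi> i. ?r i)"
      using insert.hyps by (auto simp: vec_eq_iff)
    finally show ?case using insert by (simp add: algebra_simps)
  qed
  from this [of UNIV]
  have "det (\<chi> i. axis i 1 + v $ i *s c) = 1 + (\<Sum>i\<in>UNIV. c $ i * v $ i)" by simp
  moreover have "(\<chi> i. axis i 1 + v $ i *s c) = mat 1 + (\<chi> i j. v $ i * c $ j)"
    by (auto simp: vec_eq_iff mat_def axis_def)
  ultimately show ?thesis by simp
qed

lemma matrix_inv_right_det:
  fixes M :: "'a::field ^ 'n ^ 'n::finite"
  assumes "det M \<noteq> 0"
  shows "M ** matrix_inv M = mat 1"
  using assms unfolding invertible_det_nz [symmetric] invertible_def matrix_inv_def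
  by (rule someI2_ex) blast

lemma matrix_inv_left_det:
  fixes M :: "'a::field ^ 'n ^ 'n::finite"
  assumes "det M \<noteq> 0"
  shows "matrix_inv M ** M = mat 1"
  using assms unfolding invertible_det_nz [symmetric] invertible_def matrix_inv_def
  by (rule someI2_ex) blast

text \<open>With \<open>v\<close> the solution of \<open>M *v v = u\<close>, the matrix
  \<open>M\<close> factors out on the left, which reduces the claim to a rank-one perturbation of
  the identity.\<close>

lemma matrix_determinant_lemma:
  fixes M :: "'a::field ^ 'n ^ 'n::finite" and u c :: "'a ^ 'n"
  assumes "det M \<noteq> 0"
  shows "det (M + (\<chi> i j. u $ i * c $ j)) =
    det M * (1 + (\<Sum>i\<in>UNIV. c $ i * (matrix_inv M *v u) $ i))"
proof -
  define v where "v = matrix_inv M *v u"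
  have "M *v v = u"
    by (simp add: v_def matrix_vector_mul_assoc matrix_inv_right_det [OF assms])
  then have u: "u $ i = (\<Sum>j\<in>UNIV. M $ i $ j * v $ j)" for i
    by (auto simp: matrix_vector_mult_def)
  have "M ** (\<chi> i j. v $ i * c $ j) = (\<chi> i j. u $ i * c $ j)"
    by (simp add: vec_eq_iff matrix_matrix_mult_def u sum_distrib_right mult.assoc)
  then have "M + (\<chi> i j. u $ i * c $ j) = M ** (mat 1 + (\<chi> i j. v $ i * c $ j))"
    by (simp add: matrix_add_ldistrib)
  then show ?thesis
    by (simp add: det_mul det_mat_1_plus_rank_one v_def)
qed

lemma poly_det:
  fixes M :: "'a::comm_ring_1 poly ^ 'n ^ 'n::finite"
  shows "poly (det M) z = det (\<chi> i j. poly (M $ i $ j) z)"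
  by (simp add: det_def poly_sum poly_prod)

lemma poly_rk_den: "poly (rk_den A) z = det (rk_matrix A z)"
  unfolding rk_den_def poly_det rk_matrix_def
  by (rule arg_cong [of _ _ det]) (simp add: vec_eq_iff mat_def)

text \<open>The perturbation is written as a product of coordinates of two vectors so that
  \<open>matrix_determinant_lemma\<close> applies literally.\<close>

lemma poly_rk_num:
  "poly (rk_num A b) z =
    det (rk_matrix A z + (\<chi> i j. (\<chi> i. 1) $ i * (\<chi> j. z * of_real (b $ j)) $ j))"
  unfolding rk_num_def poly_det rk_matrix_def
  by (rule arg_cong [of _ _ det]) (simp add: vec_eq_iff mat_def)

text \<open>Meaningful only where \<open>det (rk_matrix A z)\<close> is nonzero. The form matches
  the equation of the theorem at \<open>z = of_real h * \<alpha>\<close>.\<close>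

definition rk_stability :: "real ^ 'p ^ 'p \<Rightarrow> real ^ 'p::finite \<Rightarrow> complex \<Rightarrow> complex" where
  "rk_stability A b z =
    1 + z * (\<Sum>i\<in>UNIV. of_real (b $ i) * (matrix_inv (rk_matrix A z) *v (\<chi> j. 1)) $ i)"

lemma poly_rk_num_eq:
  assumes "det (rk_matrix A z) \<noteq> 0"
  shows "poly (rk_num A b) z = poly (rk_den A) z * rk_stability A b z"
  unfolding poly_rk_num poly_rk_den matrix_determinant_lemma [OF assms] rk_stability_def
  by (simp add: sum_distrib_left mult.assoc)

lemma rk_regular_value_attained:
  assumes "rk_regular_value A b w"
  obtains z where "det (rk_matrix A z) \<noteq> 0" and "rk_stability A b z = w"
proof -
  let ?F = "rk_num A b - smult w (rk_den A)"
  \<comment> \<open>The univariate Nullstellensatz has an exceptional case in which both polynomials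
    are zero; the value 1 of \<open>rk_den A\<close> at 0 rules it out.\<close>
  have "rk_matrix A 0 = mat 1"
    by (simp add: rk_matrix_def vec_eq_iff)
  then have "poly (rk_den A) 0 = 1" by (simp add: poly_rk_den)
  then have "rk_den A \<noteq> 0" by auto
  then obtain z where z: "poly ?F z = 0" "poly (rk_den A) z \<noteq> 0"
    using assms nullstellensatz_univariate [of ?F "rk_den A"]
    unfolding rk_regular_value_def by blast
  from z(2) have d: "det (rk_matrix A z) \<noteq> 0" by (simp add: poly_rk_den)
  with z have "rk_stability A b z = w"
    by (simp add: poly_rk_num_eq)
  with d show thesis by (rule that)
qed

text \<open>Turns existence and uniqueness of the stages into linear algebra for
  \<open>rk_matrix\<close>.\<close>

lemma rk_stages_linear_iff:
  "rk_stages A h (\<lambda>z. \<alpha> * z) x k \<longleftrightarrow>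
    rk_matrix A (of_real h * \<alpha>) *v (\<chi> i. k i) = (\<chi> i. \<alpha> * x)"
proof -
  have "(rk_matrix A (of_real h * \<alpha>) *v (\<chi> i. k i)) $ i =
      k i - \<alpha> * (h *\<^sub>R (\<Sum>j\<in>UNIV. (A $ i $ j) *\<^sub>R k j))" for i
    unfolding rk_matrix_def matrix_vector_mult_diff_rdistrib matrix_vector_mul_lid
    by (simp add: matrix_vector_mult_def sum_distrib_left scaleR_conv_of_real mult_ac)
  then have "(rk_matrix A (of_real h * \<alpha>) *v (\<chi> i. k i)) $ i = \<alpha> * x \<longleftrightarrow>
      k i = \<alpha> * (x + h *\<^sub>R (\<Sum>j\<in>UNIV. (A $ i $ j) *\<^sub>R k j))" for i
    by (simp only: diff_eq_eq distrib_left)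
  then show ?thesis
    by (simp add: rk_stages_def vec_eq_iff)
qed

text \<open>Stated as an equation for \<open>k\<close>, so that it yields unique existence at once
  and also evaluates the \<open>THE\<close> in \<open>rk_step\<close>.\<close>

lemma rk_stages_linear_unique:
  assumes "det (rk_matrix A (of_real h * \<alpha>)) \<noteq> 0"
  shows "rk_stages A h (\<lambda>z. \<alpha> * z) x k \<longleftrightarrow>
    k = (\<lambda>i. \<alpha> * x * (matrix_inv (rk_matrix A (of_real h * \<alpha>)) *v (\<chi> j. 1)) $ i)"
proof -
  let ?M = "rk_matrix A (of_real h * \<alpha>)"
  have "?M *v v = w \<longleftrightarrow> v = matrix_inv ?M *v w" for v w
    by (metis matrix_inv_left_det [OF assms] matrix_inv_right_det [OF assms]
        matrix_vector_mul_assoc matrix_vector_mul_lid)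
  then have "rk_stages A h (\<lambda>z. \<alpha> * z) x k \<longleftrightarrow>
      (\<chi> i. k i) = matrix_inv ?M *v (\<chi> i. \<alpha> * x)"
    unfolding rk_stages_linear_iff by blast
  moreover have "(\<chi> i. \<alpha> * x) = (\<alpha> * x) *s (\<chi> i. 1)"
    by (simp add: vec_eq_iff)
  then have "matrix_inv ?M *v (\<chi> i. \<alpha> * x) = (\<alpha> * x) *s (matrix_inv ?M *v (\<chi> i. 1))"
    by (metis vector_scalar_commute)
  ultimately show ?thesis
    by (simp add: vec_eq_iff fun_eq_iff)
qed

lemma rk_step_linear:
  assumes "det (rk_matrix A (of_real h * \<alpha>)) \<noteq> 0"
  shows "rk_step A b h (\<lambda>z. \<alpha> * z) x = rk_stability A b (of_real h * \<alpha>) * x"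
  unfolding rk_step_def rk_stages_linear_unique [OF assms] the_eq_trivial rk_stability_def
  by (simp add: scaleR_conv_of_real algebra_simps sum_distrib_left)

text \<open>Adding a kernel vector of the matrix to one family of stages gives another, so
  uniqueness forces a trivial kernel.\<close>

lemma det_rk_matrix_nonzero:
  assumes "\<exists>!k. rk_stages A h (\<lambda>z. \<alpha> * z) x k"
  shows "det (rk_matrix A (of_real h * \<alpha>)) \<noteq> 0"
proof -
  let ?M = "rk_matrix A (of_real h * \<alpha>)"
  from assms obtain k where k: "rk_stages A h (\<lambda>z. \<alpha> * z) x k"
    and uniq: "\<And>k'. rk_stages A h (\<lambda>z. \<alpha> * z) x k' \<Longrightarrow> k' = k" by blast
  have "v = 0" if "?M *v v = 0" for v
  proof -
    have "(\<chi> i. k i + v $ i) = (\<chi> i. k i) + v" by (simp add: vec_eq_iff)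
    then have "rk_stages A h (\<lambda>z. \<alpha> * z) x (\<lambda>i. k i + v $ i)"
      using k that by (simp add: rk_stages_linear_iff matrix_vector_right_distrib)
    from uniq [OF this] show ?thesis by (simp add: fun_eq_iff vec_eq_iff)
  qed
  then show ?thesis
    using matrix_left_invertible_ker [of ?M] invertible_det_nz [of ?M] invertible_left_inverse [of ?M]
    by blast
qed

text \<open>The integrating factor \<open>exp (- lam * s)\<close> turns any solution into a function
  with zero derivative, hence into a constant.\<close>

lemma solves_target_step:
  assumes "solves_target lam u"
  shows "u (t + h) = exp (of_real h * lam) * u t"
proof -
  define g where "g s = exp (s *\<^sub>R (- lam)) * u s" for s
  have "(g has_vector_derivative 0) (at s within UNIV)" for s
  proof -
    have "(u has_vector_derivative lam * u s) (at s)"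
      using assms by (simp add: solves_target_def)
    from has_vector_derivative_mult [OF exp_scaleR_has_vector_derivative_right [of "- lam" s] this]
    show ?thesis unfolding g_def by (simp add: algebra_simps)
  qed
  then obtain C where C: "\<And>s. g s = C"
    using has_vector_derivative_zero_constant [of UNIV g] by auto
  have "exp (s *\<^sub>R lam) * g s = u s" for s
    by (simp add: g_def exp_minus)
  then have u: "u s = exp (s *\<^sub>R lam) * C" for s
    by (simp add: C)
  show ?thesis
    by (simp add: u exp_add scaleR_conv_of_real algebra_simps)
qed

theorem theorem3p1:
  fixes h :: real and lam :: complex
    and A :: "real ^ 'p ^ 'p::finite" and b :: "real ^ 'p"
    and N :: "complex \<Rightarrow> real" and D :: "(complex \<times> complex) set"
  assumes step_size: "h > 0"
    and loss_norm: "is_norm N"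
    and finite_data: "finite D"
    and data: "\<forall>(x, y)\<in>D. \<exists>u n. solves_target lam u \<and>
                  x = u (real n * h) \<and> y = u (real (Suc n) * h)"
    and not_all_zero: "\<exists>(x, y)\<in>D. x \<noteq> 0"
    and regular: "rk_regular_value A b (exp (of_real h * lam))"
  shows "(\<forall>(x, y)\<in>D. y = exp (of_real h * lam) * x) \<and>
    (\<exists>\<alpha>. (\<forall>(x, y)\<in>D. \<exists>!k. rk_stages A h (\<lambda>z. \<alpha> * z) x k) \<and>
         (\<Sum>(x, y)\<in>D. N (exp (of_real h * lam) * x - rk_step A b h (\<lambda>z. \<alpha> * z) x)) = 0) \<and>
    (\<forall>\<alpha>. (\<forall>(x, y)\<in>D. \<exists>!k. rk_stages A h (\<lambda>z. \<alpha> * z) x k) \<and>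
         (\<Sum>(x, y)\<in>D. N (exp (of_real h * lam) * x - rk_step A b h (\<lambda>z. \<alpha> * z) x)) = 0 \<longrightarrow>
         1 + of_real h * \<alpha> * (\<Sum>i\<in>UNIV. of_real (b $ i) *
             (matrix_inv (rk_matrix A (of_real h * \<alpha>)) *v (\<chi> j. 1)) $ i)
           - exp (of_real h * lam) = 0 \<and>
         det (rk_matrix A (of_real h * \<alpha>)) \<noteq> 0)"
proof -
  let ?w = "exp (of_real h * lam)"
  let ?stages = "\<lambda>\<alpha>. \<forall>(x, y)\<in>D. \<exists>!k. rk_stages A h (\<lambda>z. \<alpha> * z) x k"
  let ?loss = "\<lambda>\<alpha>. \<Sum>(x, y)\<in>D. N (?w * x - rk_step A b h (\<lambda>z. \<alpha> * z) x)"
  have N_eq_0: "N x = 0 \<longleftrightarrow> x = 0" for x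
    using loss_norm by (simp add: is_norm_def)
  have N_nonneg: "N x \<ge> 0" for x
  proof -
    \<comment> \<open>The triangle inequality for \<open>x\<close> and \<open>- x\<close> reads
      \<open>0 \<le> 2 * N x\<close>.\<close>
    have "N (x + (-1) *\<^sub>R x) \<le> N x + N ((-1) *\<^sub>R x)" and "N ((-1) *\<^sub>R x) = \<bar>-1\<bar> * N x"
      using loss_norm unfolding is_norm_def by blast+
    then show ?thesis using N_eq_0 [of 0] by simp
  qed
  have loss_0: "?loss \<alpha> = 0 \<longleftrightarrow> (\<forall>(x, y)\<in>D. ?w * x = rk_step A b h (\<lambda>z. \<alpha> * z) x)" for \<alpha>
    by (subst sum_nonneg_eq_0_iff [OF finite_data]) (auto simp: N_nonneg N_eq_0)
  obtain x0 y0 where x0: "(x0, y0) \<in> D" "x0 \<noteq> 0"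
    using not_all_zero by auto
  have "\<forall>(x, y)\<in>D. y = ?w * x"
  proof (clarify)
    fix x y assume "(x, y) \<in> D"
    with data obtain u n where "solves_target lam u" "x = u (real n * h)" "y = u (real (Suc n) * h)"
      by blast
    then show "y = ?w * x"
      using solves_target_step [of lam u "real n * h" h] by (simp add: algebra_simps)
  qed
  moreover have "\<exists>\<alpha>. ?stages \<alpha> \<and> ?loss \<alpha> = 0"
  proof -
    obtain z where z: "det (rk_matrix A z) \<noteq> 0" "rk_stability A b z = ?w"
      using rk_regular_value_attained [OF regular] .
    \<comment> \<open>The witness is \<open>\<alpha> = z / h\<close>, with \<open>z\<close> a point
      where the stability function takes the value \<open>?w\<close>.\<close>
    have hz: "of_real h * (z / of_real h) = z" using step_size by simp
    have d: "det (rk_matrix A (of_real h * (z / of_real h))) \<noteq> 0"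
      using z(1) by (simp only: hz not_False_eq_True)
    have "?stages (z / of_real h)"
      unfolding rk_stages_linear_unique [OF d] by simp
    moreover have "?loss (z / of_real h) = 0"
      unfolding loss_0 unfolding rk_step_linear [OF d] hz z(2) by simp
    ultimately show ?thesis by blast
  qed
  moreover have "rk_stability A b (of_real h * \<alpha>) - ?w = 0 \<and> det (rk_matrix A (of_real h * \<alpha>)) \<noteq> 0"
    if "?stages \<alpha> \<and> ?loss \<alpha> = 0" for \<alpha>
  proof -
    \<comment> \<open>The single datum \<open>x0\<close> suffices: its unique stages give the
      determinant condition, and cancelling \<open>x0 \<noteq> 0\<close> from its zero loss term
      gives the equation.\<close>
    from that x0(1) have d: "det (rk_matrix A (of_real h * \<alpha>)) \<noteq> 0"
      by (intro det_rk_matrix_nonzero [of _ _ _ x0]) blast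
    moreover have "?w * x0 = rk_step A b h (\<lambda>z. \<alpha> * z) x0"
      using that x0(1) unfolding loss_0 by blast
    then have "?w * x0 = rk_stability A b (of_real h * \<alpha>) * x0"
      by (simp only: rk_step_linear [OF d])
    ultimately show ?thesis using x0(2) by simp
  qed
  ultimately show ?thesis unfolding rk_stability_def by blast
qed

end
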